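(* Let $n\ge 1$, let $a_1,\dots,a_n\in\mathbb{R}$, and let $a^m_1,\dots,a^m_n>0$ be such that the companion matrix $A_m$ defined in the context is Hurwitz. Let $k>0$, $\gamma>0$, and let $P=P^\top>0$, $Q=Q^\top>0$ in $\mathbb{R}^{n\times n}$ satisfy $PA_m+A_m^\top P=-Q$. Let $b=e_n$, let $A$ be the companion matrix defined in the context, and let $\theta=\mathrm{col}(a_1-a^m_1,\dots,a_n-a^m_n)$, so that $A+b\theta^\top=A_m$. Consider the plant $\dot x=Ax+bu$ with state $x(t)\in\mathbb{R}^n$ and input $u(t)\in\mathbb{R}$. Set $$K_I=k\,\mathrm{col}(a^m_1,a^m_2,\dots,a^m_n),\qquad K_P=k\,e_n,$$ which do not depend on the unknown plant parameters $a_1,\dots,a_n$ (equivalently, on $\theta$). Then: (P1) Independently of the parameter estimation, i.e. for any signal $\hat\theta(t)\in\mathbb{R}^n$, however it is generated, with $\tilde\theta:=\hat\theta-\theta$, the signal $u$ generated by the control law $\dot u=-k(u-\hat\theta^\top x)$ applied to the plant coincides exactly with the output $u$ of the perturbed linear time-invariant, full-state feedback PI controller $$\dot v=-K_I^\top x+k\,\tilde\theta^\top x,\qquad u=v-K_P^\top x,$$ for a suitable initial condition $v(0)$. (P2) If the $\mathcal{L}_1$-adaptive controller $$\dot u=-k(u-\hat\theta^\top x),\qquad \dot{\hat x}=A_m\hat x-b(\hat\theta^\top x-u),\qquad \dot{\hat\theta}=\gamma\,x\,(\hat x-x)^\top Pb$$ in closed loop with the plant ensures boundedness of trajectories (all closed-loop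 trajectories are bounded for all initial conditions), then along the trajectories $$\lim_{t\to\infty}|\tilde\theta^\top(t)x(t)|=0 .$$ Consequently, the (bounded state) $\mathcal{L}_1$-adaptive controller always converges to the unperturbed PI controller $\dot v=-K_I^\top x$, $u=v-K_P^\top x$, in the sense that the perturbation term $k\tilde\theta^\top x$ in its representation in (P1) converges to zero. (P3) If the PI controller $$\dot v=-K_I^\top x,\qquad u=v-K_P^\top x$$ does not ensure stability (in the sense of Lyapunov, not necessarily asymptotic) of its closed loop with the plant, then the $\mathcal{L}_1$-adaptive controller of (P2) does not ensure boundedness of the trajectories of its closed loop with the plant.
   Context: Notation: $e_n$ is the $n$-th vector of the Euclidean basis of $\mathbb{R}^n$, $\mathrm{col}(\cdot)$ denotes a column vector, and $|\cdot|$ is the absolute value (Euclidean norm). The matrices are $$A=\begin{bmatrix}0&1&0&\dots&0\\0&0&1&\dots&0\\ \vdots&\vdots&\vdots&&\vdots\\0&0&0&\dots&1\\-a_1&-a_2&-a_3&\dots&-a_n\end{bmatrix},\qquad A_m=\begin{bmatrix}0&1&0&\dots&0\\0&0&1&\dots&0\\ \vdots&\vdots&\vdots&&\vdots\\0&0&0&\dots&1\\-a^m_1&-a^m_2&-a^m_3&\dots&-a^m_n\end{bmatrix}.$$ The coefficients $a_i$ (hence $\theta$) are unknown, while the $a^m_i$, $k$, $\gamma$, $P$, $Q$ are chosen by the designer. The state $x$ is measured. A controller is called implementable if its gains are independent of the unknown plant parameters. The $\mathcal{L}_1$-adaptive controller consists of the control law for $u$ (a filtered version of $\hat\theta^\top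 x$) together with the state predictor $\hat x\in\mathbb{R}^n$ and the parameter estimator $\hat\theta\in\mathbb{R}^n$ displayed in (P2). Its closed loop with the plant is the autonomous system with state $(x,u,\hat x,\hat\theta)$. The parameter error is $\tilde\theta=\hat\theta-\theta$. The closed loop of the plant with the unperturbed PI controller is the linear time-invariant system with state $(x,v)$. A matrix is Hurwitz if all its eigenvalues have strictly negative real part. *)

theory Defs
  imports "HOL-Analysis.Analysis"
begin

text \<open>Coordinates are indexed by a finite linearly ordered type. The position of an index in
  the increasing enumeration identifies the index type with \<open>{1..n}\<close>, where \<open>n = CARD('n)\<close>.\<close>

type_synonym 'n rvec = "(real, 'n) vec"
type_synonym 'n rmat = "((real, 'n) vec, 'n) vec"

definition pos :: "'n::{finite,linorder} \<Rightarrow> nat" where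
  "pos i = card {..i}"

definition e_last :: "'n::{finite,linorder} rvec" where
  "e_last = axis (Max UNIV) 1"

definition companion :: "'n::{finite,linorder} rvec \<Rightarrow> 'n rmat" where
  "companion a = (\<chi> i j. if pos i = CARD('n) then - (a $ j)
                         else if pos j = pos i + 1 then 1 else 0)"

definition hurwitz :: "real ^ 'n ^ 'n \<Rightarrow> bool" where
  "hurwitz M \<longleftrightarrow> (\<forall>(c::complex) (w :: complex ^ 'n).
     w \<noteq> 0 \<and> map_matrix complex_of_real M *v w = c *s w \<longrightarrow> Re c < 0)"

definition sym_pos_def :: "real ^ 'n ^ 'n \<Rightarrow> bool" where
  "sym_pos_def M \<longleftrightarrow> transpose M = M \<and> (\<forall>x. x \<noteq> 0 \<longrightarrow> x \<bullet> (M *v x) > 0)"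

definition time_dom :: "ereal \<Rightarrow> real set" where
  "time_dom T = {t. 0 \<le> t \<and> ereal t < T}"

definition solution ::
  "(real \<Rightarrow> 'a::real_normed_vector \<Rightarrow> 'a) \<Rightarrow> ereal \<Rightarrow> (real \<Rightarrow> 'a) \<Rightarrow> bool" where
  "solution f T z \<longleftrightarrow>
     (\<forall>t\<in>time_dom T. (z has_vector_derivative f t (z t)) (at t within time_dom T))"

text \<open>Solutions in the sense of Caratheodory, for right-hand sides that are not continuous in
  time. For continuous right-hand sides they are the solutions above.\<close>

definition caratheodory_solution ::
  "(real \<Rightarrow> 'a::euclidean_space \<Rightarrow> 'a) \<Rightarrow> ereal \<Rightarrow> (real \<Rightarrow> 'a) \<Rightarrow> bool" where
  "caratheodory_solution f T z \<longleftrightarrow>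
     (\<forall>t\<in>time_dom T. (\<lambda>s. f s (z s)) absolutely_integrable_on {0..t} \<and>
        z t = z 0 + integral {0..t} (\<lambda>s. f s (z s)))"

text \<open>For an autonomous system. The trajectories range over all solutions on \<open>[0, T)\<close>
  with \<open>0 < T \<le> \<infinity>\<close>, so a trajectory with finite escape time counts as unbounded.\<close>

definition bounded_trajectories :: "('a::real_normed_vector \<Rightarrow> 'a) \<Rightarrow> bool" where
  "bounded_trajectories f \<longleftrightarrow>
     (\<forall>T z. solution (\<lambda>_. f) T z \<longrightarrow> bounded (z ` time_dom T))"

text \<open>Lyapunov stability of the equilibrium at the origin.\<close>

definition lyapunov_stable :: "('a::real_normed_vector \<Rightarrow> 'a) \<Rightarrow> bool" where
  "lyapunov_stable f \<longleftrightarrow>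
     (\<forall>\<epsilon>>0. \<exists>\<delta>>0. \<forall>T z. solution (\<lambda>_. f) T z \<and> norm (z 0) < \<delta> \<longrightarrow>
        (\<forall>t\<in>time_dom T. norm (z t) < \<epsilon>))"

text \<open>\<open>a\<close> holds the plant parameters, \<open>am\<close> those of the reference model, and
  \<open>th\<close>, \<open>xh\<close> stand for \<open>\<theta>\<close>-hat and \<open>x\<close>-hat.\<close>

definition plant :: "'n::{finite,linorder} rvec \<Rightarrow> 'n rvec \<Rightarrow> real \<Rightarrow> 'n rvec" where
  "plant a x u = companion a *v x + u *\<^sub>R e_last"

definition theta :: "'n::{finite,linorder} rvec \<Rightarrow> 'n rvec \<Rightarrow> 'n rvec" where
  "theta a am = a - am"

lemma pos_eq_CARD_iff: "pos i = CARD('n) \<longleftrightarrow> i = Max UNIV"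
  for i :: "'n::{finite,linorder}"
proof
  assume "pos i = CARD('n)"
  then have "{..i} = UNIV"
    unfolding pos_def by (simp add: card_eq_UNIV_imp_eq_UNIV)
  then show "i = Max UNIV"
    by (metis Max_eqI UNIV_I atMost_iff finite_code)
next
  assume "i = Max UNIV"
  then have "{..i} = UNIV" by auto
  then show "pos i = CARD('n)" by (simp add: pos_def)
qed

lemma companion_matching:
  "companion a + (\<chi> i j. e_last $ i * theta a am $ j) = companion am"
  by (auto simp: vec_eq_iff companion_def e_last_def theta_def axis_def pos_eq_CARD_iff)

definition K_I :: "real \<Rightarrow> real ^ 'n \<Rightarrow> real ^ 'n" where
  "K_I k am = k *\<^sub>R am"

definition K_P :: "real \<Rightarrow> 'n::{finite,linorder} rvec" where
  "K_P k = k *\<^sub>R e_last"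

definition control_law :: "real \<Rightarrow> real ^ 'n \<Rightarrow> real ^ 'n \<Rightarrow> real \<Rightarrow> real" where
  "control_law k th x u = - k * (u - th \<bullet> x)"

text \<open>Plant with the control law driven by an arbitrary signal, state \<open>(x, u)\<close>.\<close>

definition filtered_loop ::
  "'n::{finite,linorder} rvec \<Rightarrow> real \<Rightarrow> (real \<Rightarrow> 'n rvec)
    \<Rightarrow> real \<Rightarrow> ('n rvec \<times> real) \<Rightarrow> ('n rvec \<times> real)" where
  "filtered_loop a k th t = (\<lambda>(x, u). (plant a x u, control_law k (th t) x u))"

text \<open>Plant with the perturbed PI controller, state \<open>(x, v)\<close>; \<open>err\<close> is the parameter error.\<close>

definition perturbed_PI_loop ::
  "'n::{finite,linorder} rvec \<Rightarrow> 'n rvec \<Rightarrow> real \<Rightarrow> (real \<Rightarrow> 'n rvec)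
    \<Rightarrow> real \<Rightarrow> ('n rvec \<times> real) \<Rightarrow> ('n rvec \<times> real)" where
  "perturbed_PI_loop a am k err t = (\<lambda>(x, v).
     (plant a x (v - K_P k \<bullet> x), - (K_I k am \<bullet> x) + k * (err t \<bullet> x)))"

definition PI_loop ::
  "'n::{finite,linorder} rvec \<Rightarrow> 'n rvec \<Rightarrow> real \<Rightarrow> ('n rvec \<times> real) \<Rightarrow> ('n rvec \<times> real)" where
  "PI_loop a am k = (\<lambda>(x, v). (plant a x (v - K_P k \<bullet> x), - (K_I k am \<bullet> x)))"

text \<open>Plant with the adaptive controller, state \<open>(x, u, xh, th)\<close>.\<close>

definition L1_loop ::
  "'n::{finite,linorder} rvec \<Rightarrow> 'n rvec \<Rightarrow> real \<Rightarrow> real \<Rightarrow> 'n rmat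
    \<Rightarrow> ('n rvec \<times> real \<times> 'n rvec \<times> 'n rvec)
    \<Rightarrow> ('n rvec \<times> real \<times> 'n rvec \<times> 'n rvec)" where
  "L1_loop a am k \<gamma> P = (\<lambda>(x, u, xh, th).
     (plant a x u,
      control_law k th x u,
      companion am *v xh - (th \<bullet> x - u) *\<^sub>R e_last,
      (\<gamma> * ((xh - x) \<bullet> (P *v e_last))) *\<^sub>R x))"

end

theory Submission
  imports Defs
begin

text \<open>
  Write \<open>xh\<close>, \<open>th\<close> for the estimates of \<open>x\<close>, \<open>\<theta>\<close>. The three claims rest on a linear change
  of coordinates, an energy estimate and an invariant affine subspace of the adaptive loop.

  Since \<open>e\<^sub>n\<close> reads off the last row of the companion matrix, \<open>v = u + K\<^sub>P\<^sup>T x\<close> satisfies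
  \<open>v' = - k (u - th\<^sup>T x) + k (u - a\<^sup>T x) = k (th - a)\<^sup>T x\<close>, and
  \<open>th - a = (th - \<theta>) - a\<^sup>m\<close>. The control law is therefore the perturbed PI controller written
  in other linear coordinates, and linear coordinate changes carry solutions to solutions
  (\<open>solution_affine_image\<close>, \<open>caratheodory_solution_linear_image\<close>). This is (P1).

  For (P2), let \<open>e = xh - x\<close> and \<open>y = (th - \<theta>)\<^sup>T x\<close>. Then \<open>e' = A\<^sub>m e - y b\<close>, and
  the estimator is designed so that \<open>V = e\<^sup>T P e + \<parallel>th - \<theta>\<parallel>\<^sup>2 / \<gamma>\<close> has
  \<open>V' = - e\<^sup>T Q e\<close>. Every continuous function of a bounded trajectory is uniformly continuous in
  time (\<open>bounded_solution_uniformly_continuous\<close>), so Barbalat's lemma applies freely: to \<open>V\<close>,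
  which gives \<open>e \<rightarrow> 0\<close>, and to the last component of \<open>e\<close>, whose derivative then tends to zero and
  equals \<open>- y\<close> up to a term linear in \<open>e\<close>.

  For (P3), the adaptive loop contains the PI loop: with \<open>xh = x\<close> and \<open>th = \<theta>\<close> both the
  prediction error and the adaptation vanish identically, so each PI trajectory is, up to the
  change of coordinates, part of an adaptive trajectory (\<open>L1_loop_contains_PI_loop\<close>). Bounded
  adaptive trajectories hence force bounded PI trajectories, and a linear system with bounded
  trajectories is stable (\<open>linear_bounded_imp_lyapunov_stable\<close>), by superposition of finitely
  many basis solutions.
\<close>

section \<open>Images of solutions under coordinate changes\<close>

lemma solution_affine_image:
  assumes z: "solution f T z" and L: "bounded_linear L"
    and f': "\<And>t y. f' t (L y + c) = L (f t y)"
  shows "solution f' T (\<lambda>t. L (z t) + c)"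
  unfolding solution_def
proof
  fix t assume t: "t \<in> time_dom T"
  have "((\<lambda>t. L (z t) + c) has_vector_derivative L (f t (z t)) + 0) (at t within time_dom T)"
    using z t unfolding solution_def
    by (intro has_vector_derivative_add has_vector_derivative_const
        bounded_linear.has_vector_derivative[OF L]) auto
  then show "((\<lambda>t. L (z t) + c) has_vector_derivative f' t (L (z t) + c)) (at t within time_dom T)"
    by (simp add: f')
qed

lemma caratheodory_solution_linear_image:
  assumes z: "caratheodory_solution f T z" and L: "bounded_linear L"
    and f': "\<And>t y. f' t (L y) = L (f t y)"
  shows "caratheodory_solution f' T (\<lambda>t. L (z t))"
  unfolding caratheodory_solution_def
proof
  fix t assume t: "t \<in> time_dom T"
  let ?g = "\<lambda>s. f s (z s)"
  have g: "?g absolutely_integrable_on {0..t}" and zt: "z t = z 0 + integral {0..t} ?g"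
    using z t unfolding caratheodory_solution_def by auto
  have "(L \<circ> ?g) absolutely_integrable_on {0..t}"
    by (rule absolutely_integrable_linear[OF g L])
  moreover have "L (z t) = L (z 0) + integral {0..t} (L \<circ> ?g)"
    using integral_linear[OF set_lebesgue_integral_eq_integral(1)[OF g] L]
    by (subst zt) (simp add: linear_add bounded_linear.linear[OF L])
  ultimately show "(\<lambda>s. f' s (L (z s))) absolutely_integrable_on {0..t} \<and>
      L (z t) = L (z 0) + integral {0..t} (\<lambda>s. f' s (L (z s)))"
    by (simp add: o_def f')
qed

section \<open>Linear systems with bounded trajectories\<close>

lemma time_dom_infinity: "time_dom \<infinity> = {0..}"
  by (auto simp: time_dom_def)

lemma time_dom_segment: "t \<in> time_dom T \<Longrightarrow> {0..t} \<subseteq> time_dom T"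
  by (auto simp: time_dom_def intro: le_less_trans[of "ereal s" "ereal t" for s])

lemma nonpos_derivative_imp_nonincreasing_within:
  fixes w :: "real \<Rightarrow> real"
  assumes st: "s \<le> t" "{s..t} \<subseteq> S"
    and w: "\<And>r. r \<in> S \<Longrightarrow> (w has_vector_derivative w' r) (at r within S)"
    and w': "\<And>r. r \<in> S \<Longrightarrow> w' r \<le> 0"
  shows "w t \<le> w s"
proof -
  have "\<exists>r\<in>{s..t}. w t - w s = (t - s) *\<^sub>R w' r"
    using st has_derivative_subset[OF w[unfolded has_vector_derivative_def] st(2)]
    by (intro mvt_very_simple) auto
  then obtain r where r: "r \<in> {s..t}" "w t - w s = (t - s) * w' r" by auto
  have "(t - s) * w' r \<le> 0"
    using r st w' by (intro mult_nonneg_nonpos) auto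
  then show ?thesis using r by simp
qed

text \<open>The exponential series \<open>\<Sum>n. t\<^sup>n f\<^sup>n(p) / n!\<close> solves the linear system. It is
  differentiated coordinatewise, where it is a real power series.\<close>

lemma linear_solution_exists:
  fixes f :: "'a::euclidean_space \<Rightarrow> 'a"
  assumes "linear f"
  obtains z where "solution (\<lambda>_. f) \<infinity> z" "z 0 = p"
proof -
  interpret bounded_linear f using assms linear_conv_bounded_linear by blast
  obtain K where K: "K > 0" "\<And>x. norm (f x) \<le> norm x * K"
    using pos_bounded by blast
  define c where "c n = (f ^^ n) p /\<^sub>R fact n" for n
  have pow: "norm ((f ^^ n) p) \<le> K ^ n * norm p" for n
  proof (induction n)
    case (Suc n)
    have "norm ((f ^^ Suc n) p) \<le> norm ((f ^^ n) p) * K" using K(2) by simp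
    also have "\<dots> \<le> (K ^ n * norm p) * K" using Suc K(1) by (intro mult_right_mono) auto
    finally show ?case by (simp add: mult_ac)
  qed simp
  have sum: "summable (\<lambda>n. t ^ n *\<^sub>R c n)" for t
  proof (rule summable_comparison_test')
    show "summable (\<lambda>n. norm p * ((K * \<bar>t\<bar>) ^ n /\<^sub>R fact n))"
      by (intro summable_mult summable_exp_generic)
    show "norm (t ^ n *\<^sub>R c n) \<le> norm p * ((K * \<bar>t\<bar>) ^ n /\<^sub>R fact n)" if "n \<ge> 0" for n
    proof -
      have "norm (t ^ n *\<^sub>R c n) = \<bar>t\<bar> ^ n * norm ((f ^^ n) p) / fact n"
        by (simp add: c_def power_abs abs_mult divide_inverse mult_ac)
      also have "\<dots> \<le> \<bar>t\<bar> ^ n * (K ^ n * norm p) / fact n"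
        by (intro divide_right_mono mult_left_mono pow) auto
      finally show ?thesis by (simp add: power_mult_distrib divide_inverse mult_ac)
    qed
  qed
  define z where "z t = (\<Sum>n. t ^ n *\<^sub>R c n)" for t :: real
  have diffs: "diffs (\<lambda>n. c n \<bullet> i) n = f (c n) \<bullet> i" for n i
    by (simp add: diffs_def c_def scaleR field_simps del: of_nat_Suc)
  have coord: "z t \<bullet> i = (\<Sum>n. (c n \<bullet> i) * t ^ n)" for t i
    unfolding z_def
    by (simp add: bounded_linear.suminf[OF bounded_linear_inner_left sum] mult.commute)
  have rhs: "f (z t) \<bullet> i = (\<Sum>n. diffs (\<lambda>n. c n \<bullet> i) n * t ^ n)" for t i
  proof -
    have "f (z t) \<bullet> i = (\<Sum>n. f (t ^ n *\<^sub>R c n) \<bullet> i)"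
      unfolding z_def
      by (simp add: suminf[OF sum] bounded_linear.suminf[OF bounded_linear_inner_left summable[OF sum]])
    then show ?thesis by (simp add: diffs scaleR mult.commute)
  qed
  have "(z has_vector_derivative f (z t)) (at t)" for t
    unfolding has_vector_derivative_def
  proof (subst has_derivative_componentwise_within, intro ballI)
    fix i :: 'a
    have "summable (\<lambda>n. (c n \<bullet> i) * s ^ n)" for s :: real
      using bounded_linear.summable[OF bounded_linear_inner_left sum[of s], of i]
      by (simp add: mult.commute)
    then have "((\<lambda>s. z s \<bullet> i) has_field_derivative f (z t) \<bullet> i) (at t)"
      unfolding coord rhs by (rule termdiffs_strong_converges_everywhere)
    then show "((\<lambda>s. z s \<bullet> i) has_derivative (\<lambda>h. (h *\<^sub>R f (z t)) \<bullet> i)) (at t)"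
      by (simp add: has_field_derivative_def mult_commute_abs)
  qed
  then have "solution (\<lambda>_. f) \<infinity> z"
    by (simp add: solution_def has_vector_derivative_at_within)
  moreover have "z 0 = p"
    by (rule euclidean_eqI) (simp only: coord powser_zero, simp add: c_def)
  ultimately show thesis by (rule that)
qed

text \<open>Uniqueness at the origin, from the decay of \<open>exp (- 2 K t) \<parallel>z t\<parallel>\<^sup>2\<close> where \<open>K\<close> bounds
  the operator norm of \<open>f\<close>.\<close>

lemma linear_solution_zero:
  fixes f :: "'a::euclidean_space \<Rightarrow> 'a"
  assumes "linear f" and z: "solution (\<lambda>_. f) T z" "z 0 = 0" and t: "t \<in> time_dom T"
  shows "z t = 0"
proof -
  interpret bounded_linear f using assms linear_conv_bounded_linear by blast
  obtain K where K: "K > 0" "\<And>x. norm (f x) \<le> norm x * K"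
    using pos_bounded by blast
  define w where "w t = exp (- 2 * K * t) * (z t \<bullet> z t)" for t
  have "w t \<le> w 0"
  proof (rule nonpos_derivative_imp_nonincreasing_within[OF _ time_dom_segment[OF t]])
    fix r assume r: "r \<in> time_dom T"
    have dz: "(z has_vector_derivative f (z r)) (at r within time_dom T)"
      using z r by (auto simp: solution_def)
    have "((\<lambda>t. exp (- 2 * K * t)) has_vector_derivative - 2 * K * exp (- 2 * K * r))
        (at r within time_dom T)"
      unfolding has_real_derivative_iff_has_vector_derivative[symmetric]
      by (auto intro!: derivative_eq_intros)
    from bounded_bilinear.has_vector_derivative[OF bounded_bilinear_mult this
        bounded_bilinear.has_vector_derivative[OF bounded_bilinear_inner dz dz]]
    show "(w has_vector_derivative exp (- 2 * K * r) * (2 * (z r \<bullet> f (z r) - K * (z r \<bullet> z r))))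
        (at r within time_dom T)"
      unfolding w_def by (rule has_vector_derivative_eq_rhs) (simp add: algebra_simps inner_commute)
    have "z r \<bullet> f (z r) \<le> norm (z r) * norm (f (z r))" by (rule norm_cauchy_schwarz)
    also have "\<dots> \<le> norm (z r) * (norm (z r) * K)" by (intro mult_left_mono K) auto
    also have "\<dots> = K * (z r \<bullet> z r)" by (simp add: dot_square_norm power2_eq_square)
    finally show "exp (- 2 * K * r) * (2 * (z r \<bullet> f (z r) - K * (z r \<bullet> z r))) \<le> 0"
      by (simp add: mult_le_0_iff)
  qed (use t in \<open>auto simp: time_dom_def\<close>)
  then have "z t \<bullet> z t \<le> 0" by (simp add: w_def z mult_le_0_iff)
  then show ?thesis using inner_ge_zero[of "z t"] by (metis inner_eq_zero_iff order_antisym)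
qed

text \<open>The solutions \<open>\<phi> i\<close> through the basis vectors \<open>i\<close> exist for all times and are bounded by
  hypothesis. By uniqueness every solution, also one on a finite interval, is their combination with
  coefficients \<open>z 0 \<bullet> i\<close>, hence bounded by a constant multiple of \<open>\<parallel>z 0\<parallel>\<close>.\<close>

lemma linear_bounded_imp_lyapunov_stable:
  fixes f :: "'a::euclidean_space \<Rightarrow> 'a"
  assumes f: "linear f" and bdd: "bounded_trajectories f"
  shows "lyapunov_stable f"
proof -
  interpret f: linear f by (rule f)
  have "\<exists>z. solution (\<lambda>_. f) \<infinity> z \<and> z 0 = i" for i :: 'a
    using linear_solution_exists[OF f] by metis
  then obtain \<phi> where \<phi>: "\<And>i::'a. solution (\<lambda>_. f) \<infinity> (\<phi> i)" "\<And>i. \<phi> i 0 = i"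
    by metis
  have "\<exists>B. \<forall>t\<ge>0. norm (\<phi> i t) \<le> B" for i
    using bdd \<phi>(1)[of i] unfolding bounded_trajectories_def bounded_iff
    by (force simp: time_dom_infinity)
  then obtain B where B: "\<And>i t. t \<ge> 0 \<Longrightarrow> norm (\<phi> i t) \<le> B i" by metis
  have B0: "B i \<ge> 0" for i using B[of 0 i] norm_ge_zero[of "\<phi> i 0"] by linarith
  define C where "C = (\<Sum>i\<in>Basis. B i) + 1"
  have C: "C > 0" using B0 by (simp add: C_def add_nonneg_pos sum_nonneg)
  have est: "norm (z t) \<le> C * norm (z 0)"
    if z: "solution (\<lambda>_. f) T z" and t: "t \<in> time_dom T" for T z t
  proof -
    define s where "s t = (\<Sum>i\<in>Basis. (z 0 \<bullet> i) *\<^sub>R \<phi> i t)" for t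
    have t0: "t \<ge> 0" using t by (simp add: time_dom_def)
    have "solution (\<lambda>_. f) T (\<lambda>t. z t - s t)"
      unfolding solution_def
    proof
      fix r assume r: "r \<in> time_dom T"
      have "(\<phi> i has_vector_derivative f (\<phi> i r)) (at r within time_dom T)" for i
        using \<phi>(1)[of i] r unfolding solution_def time_dom_infinity
        by (auto simp: time_dom_def intro: has_vector_derivative_within_subset)
      moreover have "(z has_vector_derivative f (z r)) (at r within time_dom T)"
        using z r by (auto simp: solution_def)
      ultimately have "((\<lambda>t. z t - s t) has_vector_derivative
          f (z r) - (\<Sum>i\<in>Basis. (z 0 \<bullet> i) *\<^sub>R f (\<phi> i r))) (at r within time_dom T)"
        unfolding s_def
        by (intro has_vector_derivative_diff has_vector_derivative_sum
            bounded_linear.has_vector_derivative[OF bounded_linear_scaleR_right])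
      then show "((\<lambda>t. z t - s t) has_vector_derivative f (z r - s r)) (at r within time_dom T)"
        by (simp add: s_def f.diff f.sum f.scaleR)
    qed
    moreover have "z 0 - s 0 = 0" by (simp add: s_def \<phi> euclidean_representation)
    ultimately have "z t - s t = 0" by (rule linear_solution_zero[OF f _ _ t])
    then have "z t = s t" by simp
    then have "norm (z t) \<le> (\<Sum>i\<in>Basis. norm ((z 0 \<bullet> i) *\<^sub>R \<phi> i t))"
      by (simp only: s_def norm_sum)
    also have "\<dots> \<le> (\<Sum>i\<in>Basis. norm (z 0) * B i)"
      using B[OF t0] by (auto intro!: sum_mono mult_mono Basis_le_norm)
    also have "\<dots> = norm (z 0) * (\<Sum>i\<in>Basis. B i)"
      by (rule sum_distrib_left[symmetric])
    also have "\<dots> \<le> C * norm (z 0)"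
      unfolding C_def distrib_right by simp
    finally show ?thesis .
  qed
  show ?thesis
    unfolding lyapunov_stable_def
  proof (intro allI impI)
    fix \<epsilon> :: real assume "\<epsilon> > 0"
    show "\<exists>\<delta>>0. \<forall>T z. solution (\<lambda>_. f) T z \<and> norm (z 0) < \<delta> \<longrightarrow>
        (\<forall>t\<in>time_dom T. norm (z t) < \<epsilon>)"
    proof (intro exI[of _ "\<epsilon> / C"] conjI allI impI ballI)
      fix T z t assume z: "solution (\<lambda>_. f) T z \<and> norm (z 0) < \<epsilon> / C" and t: "t \<in> time_dom T"
      have "norm (z t) \<le> C * norm (z 0)" using est[of T z t] z t by simp
      also have "\<dots> < \<epsilon>" using conjunct2[OF z] C by (simp add: pos_less_divide_eq mult.commute)
      finally show "norm (z t) < \<epsilon>" .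
    qed (simp add: \<open>\<epsilon> > 0\<close> C)
  qed
qed

section \<open>Asymptotics along bounded trajectories\<close>

text \<open>Barbalat's lemma: a derivative value of size \<open>\<epsilon>\<close> at \<open>t\<close> persists at size \<open>\<epsilon> / 2\<close> on an
  interval of length independent of \<open>t\<close>, which moves \<open>w\<close> by a fixed amount.\<close>

lemma barbalat:
  fixes w g :: "real \<Rightarrow> real"
  assumes w: "\<And>t. t \<ge> 0 \<Longrightarrow> (w has_vector_derivative g t) (at t within {0..})"
    and lim: "(w \<longlongrightarrow> l) at_top"
    and uc: "uniformly_continuous_on {0..} g"
  shows "(g \<longlongrightarrow> 0) at_top"
proof (rule tendstoI)
  fix \<epsilon> :: real assume "\<epsilon> > 0"
  then obtain d where d: "d > 0"
    "\<And>s t. \<lbrakk>s \<ge> 0; t \<ge> 0; dist s t < d\<rbrakk> \<Longrightarrow> dist (g s) (g t) < \<epsilon> / 2"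
    using uc unfolding uniformly_continuous_on_def
    by (metis atLeast_iff half_gt_zero)
  define h where "h = d / 2"
  have h: "h > 0" "h < d" using d by (auto simp: h_def)
  have "\<epsilon> * h / 4 > 0" using \<open>\<epsilon> > 0\<close> h by simp
  from tendstoD[OF lim this] obtain N where
    N: "\<And>t. t \<ge> N \<Longrightarrow> dist (w t) l < \<epsilon> * h / 4"
    unfolding eventually_at_top_linorder by blast
  have "dist (g t) 0 < \<epsilon>" if t: "t \<ge> max N 0" for t
  proof -
    have "\<exists>s\<in>{t<..<t + h}. w (t + h) - w t = (\<lambda>x. x *\<^sub>R g s) (t + h - t)"
      using t h(1) has_derivative_subset[OF w[unfolded has_vector_derivative_def], of _ "{t..t + h}"]
      by (intro mvt_simple) auto
    then obtain s where s: "s \<in> {t<..<t + h}" "w (t + h) - w t = h * g s" by auto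
    have "\<bar>w (t + h) - w t\<bar> < \<epsilon> * h / 2"
      using N[of t] N[of "t + h"] t h by (auto simp: dist_real_def abs_real_def split: if_splits)
    then have "h * \<bar>g s\<bar> < h * (\<epsilon> / 2)" using s h by (simp add: abs_mult mult.commute)
    then have "\<bar>g s\<bar> < \<epsilon> / 2" using h by simp
    moreover have "dist (g s) (g t) < \<epsilon> / 2"
      using s t h by (intro d) (auto simp: dist_real_def)
    ultimately show ?thesis unfolding dist_real_def by linarith
  qed
  then show "\<forall>\<^sub>F t in at_top. dist (g t) 0 < \<epsilon>"
    by (rule eventually_at_top_linorderI)
qed

lemma nonincreasing_nonneg_convergent_at_top:
  fixes w :: "real \<Rightarrow> real"
  assumes dec: "\<And>s t. \<lbrakk>0 \<le> s; s \<le> t\<rbrakk> \<Longrightarrow> w t \<le> w s" and nonneg: "\<And>t. w t \<ge> 0"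
  obtains l where "(w \<longlongrightarrow> l) at_top"
proof
  have bdd: "bdd_below (w ` {0..})" using nonneg by (intro bdd_belowI[of _ 0]) auto
  show "(w \<longlongrightarrow> Inf (w ` {0..})) at_top"
  proof (rule order_tendstoI)
    fix y assume "y < Inf (w ` {0..})"
    then have "y < w t" if "t \<ge> 0" for t
      using cInf_lower[OF _ bdd, of "w t"] that by force
    then show "\<forall>\<^sub>F t in at_top. y < w t" by (auto simp: eventually_at_top_linorder)
  next
    fix y assume "Inf (w ` {0..}) < y"
    then obtain s where "s \<ge> 0" "w s < y"
      using cInf_lessD[of "w ` {0..}" y] by auto
    then have "w t < y" if "t \<ge> s" for t using dec[OF _ that] by force
    then show "\<forall>\<^sub>F t in at_top. w t < y" by (auto simp: eventually_at_top_linorder)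
  qed
qed

text \<open>A bounded trajectory has bounded velocity, hence is Lipschitz, and it stays in a compact
  ball, on which every continuous function is uniformly continuous.\<close>

lemma bounded_solution_uniformly_continuous:
  fixes f :: "'a::euclidean_space \<Rightarrow> 'a" and F :: "'a \<Rightarrow> 'b::metric_space"
  assumes z: "solution (\<lambda>_. f) \<infinity> z" and bdd: "bounded (z ` {0..})"
    and f: "continuous_on UNIV f" and F: "continuous_on UNIV F"
  shows "uniformly_continuous_on {0..} (\<lambda>t. F (z t))"
proof -
  obtain R where R: "\<And>t. t \<ge> 0 \<Longrightarrow> z t \<in> cball 0 R"
    using bdd unfolding bounded_iff by auto
  have "bounded (f ` cball 0 R)"
    using f by (intro compact_imp_bounded compact_continuous_image)
      (auto intro: continuous_on_subset)
  then obtain M where "\<forall>v\<in>f ` cball 0 R. norm v \<le> M"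
    unfolding bounded_iff by blast
  then have M: "norm (f y) \<le> M" if "y \<in> cball 0 R" for y
    using that by blast
  have "M \<ge> 0" using M[OF R[of 0]] norm_ge_zero order_trans by blast
  have "dist (z t) (z s) \<le> M * dist t s" if "s \<ge> 0" "t \<ge> 0" for s t
    unfolding dist_norm
  proof (rule differentiable_bound[where S = "{0..}" and f' = "\<lambda>r h. h *\<^sub>R f (z r)"])
    fix r :: real assume r: "r \<in> {0..}"
    show "(z has_derivative (\<lambda>h. h *\<^sub>R f (z r))) (at r within {0..})"
      using z r by (simp add: solution_def time_dom_infinity has_vector_derivative_def)
    show "onorm (\<lambda>h. h *\<^sub>R f (z r)) \<le> M"
      using mult_left_mono[OF M[OF R, of r] abs_ge_zero] r
      by (intro onorm_le) (simp add: mult.commute)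
  qed (use that in auto)
  then have "uniformly_continuous_on {0..} z"
    using \<open>M \<ge> 0\<close>
    by (intro lipschitz_on_uniformly_continuous[of M] lipschitz_onI) auto
  moreover have "uniformly_continuous_on (z ` {0..}) F"
  proof -
    have "uniformly_continuous_on (cball 0 R) F"
      using compact_uniformly_continuous[OF continuous_on_subset[OF F subset_UNIV] compact_cball] .
    moreover have "z ` {0..} \<subseteq> cball 0 R" using R by blast
    ultimately show ?thesis
      unfolding uniformly_continuous_on_def by (meson subsetD)
  qed
  ultimately show ?thesis by (rule uniformly_continuous_on_compose)
qed

text \<open>By compactness the form has a positive minimum on the unit sphere, so by homogeneity it
  dominates a positive multiple of \<open>\<parallel>x\<parallel>\<^sup>2\<close>.\<close>

lemma tendsto_zero_of_pos_def_form:
  fixes M :: "real ^ 'n ^ 'n" and e :: "'b \<Rightarrow> real ^ 'n"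
  assumes M: "sym_pos_def M" and lim: "((\<lambda>t. e t \<bullet> (M *v e t)) \<longlongrightarrow> 0) F"
  shows "(e \<longlongrightarrow> 0) F"
proof -
  let ?q = "\<lambda>x. x \<bullet> (M *v x)"
  obtain x0 where x0: "norm x0 = 1" "\<And>x. norm x = 1 \<Longrightarrow> ?q x0 \<le> ?q x"
  proof -
    have "continuous_on (sphere 0 1) ?q"
      by (intro continuous_intros linear_continuous_on matrix_vector_mul_bounded_linear)
    moreover have "sphere (0 :: real ^ 'n) 1 \<noteq> {}" by simp
    ultimately show thesis
      using continuous_attains_inf[of "sphere 0 1" ?q] that by force
  qed
  have "x0 \<noteq> 0" using x0(1) by auto
  then have c: "?q x0 > 0" using M unfolding sym_pos_def_def by blast
  have "?q x0 * (norm x)\<^sup>2 \<le> ?q x" for x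
  proof (cases "x = 0")
    case False
    have "?q x0 \<le> ?q (x /\<^sub>R norm x)" using False by (intro x0) simp
    also have "\<dots> = ?q x / (norm x)\<^sup>2"
      by (simp add: matrix_vector_mult_scaleR power2_eq_square divide_inverse)
    finally show ?thesis using False by (simp add: field_simps)
  qed simp
  then have "norm ((norm (e t))\<^sup>2) \<le> ?q (e t) / ?q x0" for t
    using c by (simp add: field_simps)
  moreover have "((\<lambda>t. ?q (e t) / ?q x0) \<longlongrightarrow> 0) F"
    using tendsto_divide[OF lim tendsto_const, of "?q x0"] c by simp
  ultimately have "((\<lambda>t. (norm (e t))\<^sup>2) \<longlongrightarrow> 0) F"
    by (intro Lim_null_comparison[of "\<lambda>t. (norm (e t))\<^sup>2"] always_eventually allI)
  from tendsto_real_sqrt[OF this] show ?thesis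
    by (simp add: tendsto_norm_zero_iff)
qed

section \<open>The control law as a PI controller\<close>

lemma e_last_inner_e_last [simp]: "e_last \<bullet> (e_last :: 'n::{finite,linorder} rvec) = 1"
  by (simp add: e_last_def inner_axis_axis)

lemma e_last_inner_companion: "e_last \<bullet> (companion a *v x) = - (a \<bullet> x)"
  by (simp add: e_last_def inner_axis' matrix_vector_mult_def companion_def pos_eq_CARD_iff)
    (simp add: inner_vec_def sum_negf)

lemma e_last_inner_plant: "e_last \<bullet> plant a x u = u - a \<bullet> x"
  by (simp add: plant_def inner_add_right e_last_inner_companion)

definition PI_coordinates :: "real \<Rightarrow> 'n::{finite,linorder} rvec \<times> real \<Rightarrow> 'n rvec \<times> real" where
  "PI_coordinates k = (\<lambda>(x, u). (x, u + K_P k \<bullet> x))"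

lemma bounded_linear_PI_coordinates: "bounded_linear (PI_coordinates k)"
  unfolding PI_coordinates_def linear_conv_bounded_linear[symmetric]
  by (rule linearI) (auto simp: algebra_simps)

lemma perturbed_PI_loop_PI_coordinates:
  "perturbed_PI_loop a am k (\<lambda>t. th t - theta a am) t (PI_coordinates k z) =
    PI_coordinates k (filtered_loop a k th t z)"
  by (cases z)
    (simp add: perturbed_PI_loop_def filtered_loop_def PI_coordinates_def K_P_def K_I_def
      control_law_def theta_def e_last_inner_plant algebra_simps)

lemma perturbed_PI_of_filtered:
  assumes "solution (filtered_loop a k th) T (\<lambda>t. (x t, u t))"
  shows "solution (perturbed_PI_loop a am k (\<lambda>t. th t - theta a am)) T
    (\<lambda>t. (x t, u t + K_P k \<bullet> x t))"
  using solution_affine_image[OF assms bounded_linear_PI_coordinates[of k],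
      of "perturbed_PI_loop a am k (\<lambda>t. th t - theta a am)" 0]
  by (simp add: perturbed_PI_loop_PI_coordinates) (simp add: PI_coordinates_def)

lemma caratheodory_perturbed_PI_of_filtered:
  assumes "caratheodory_solution (filtered_loop a k th) T (\<lambda>t. (x t, u t))"
  shows "caratheodory_solution (perturbed_PI_loop a am k (\<lambda>t. th t - theta a am)) T
    (\<lambda>t. (x t, u t + K_P k \<bullet> x t))"
  using caratheodory_solution_linear_image[OF assms bounded_linear_PI_coordinates[of k],
      of "perturbed_PI_loop a am k (\<lambda>t. th t - theta a am)"]
  by (simp add: perturbed_PI_loop_PI_coordinates) (simp add: PI_coordinates_def)

section \<open>Convergence of the adaptive loop\<close>

lemma continuous_on_matrix_vector_mult [continuous_intros]:
  fixes M :: "real ^ 'n ^ 'm"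
  shows "continuous_on S f \<Longrightarrow> continuous_on S (\<lambda>x. M *v f x)"
  by (rule bounded_linear.continuous_on[OF matrix_vector_mul_bounded_linear])

lemma continuous_L1_loop: "continuous_on UNIV (L1_loop a am k \<gamma> P)"
  unfolding L1_loop_def control_law_def plant_def case_prod_beta
  by (intro continuous_intros)

lemma L1_loop_imp_filtered_loop:
  assumes "solution (\<lambda>_. L1_loop a am k \<gamma> P) T (\<lambda>t. (x t, u t, xh t, th t))"
  shows "solution (filtered_loop a k th) T (\<lambda>t. (x t, u t))"
  unfolding solution_def
proof
  fix t assume t: "t \<in> time_dom T"
  have "bounded_linear (\<lambda>z :: 'a rvec \<times> real \<times> 'a rvec \<times> 'a rvec. (fst z, fst (snd z)))"
    by (intro bounded_linear_Pair bounded_linear_fst_comp bounded_linear_snd_comp bounded_linear_ident)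
  from bounded_linear.has_vector_derivative[OF this] assms t
  show "((\<lambda>t. (x t, u t)) has_vector_derivative filtered_loop a k th t (x t, u t))
      (at t within time_dom T)"
    unfolding solution_def L1_loop_def filtered_loop_def by fastforce
qed

text \<open>The unknown parameters enter the prediction error only through \<open>(th - \<theta>)\<^sup>T x\<close>, because
  \<open>A + b \<theta>\<^sup>T = A\<^sub>m\<close>.\<close>

lemma prediction_error_field:
  "companion am *v xh - (th \<bullet> x - u) *\<^sub>R e_last - plant a x u =
    companion am *v (xh - x) - ((th - theta a am) \<bullet> x) *\<^sub>R e_last"
proof -
  have "companion am *v x = companion a *v x + (theta a am \<bullet> x) *\<^sub>R e_last"
    by (simp add: companion_matching[symmetric, of am a] matrix_vector_mult_add_rdistrib)
      (simp add: vec_eq_iff matrix_vector_mult_def inner_vec_def sum_distrib_left mult_ac)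
  then show ?thesis
    by (simp add: plant_def matrix_vector_mult_diff_distrib inner_diff_left algebra_simps)
qed

lemma inner_matrix_symmetric:
  fixes P :: "real ^ 'n ^ 'n"
  assumes "transpose P = P"
  shows "(P *v x) \<bullet> y = x \<bullet> (P *v y)"
  using dot_lmul_matrix[of x P y] assms by (metis vector_transpose_matrix)

lemma lyapunov_equation_form:
  fixes P Q M :: "real ^ 'n ^ 'n"
  assumes P: "transpose P = P" and eq: "P ** M + transpose M ** P = - Q"
  shows "2 * ((M *v e) \<bullet> (P *v e)) = - (e \<bullet> (Q *v e))"
proof -
  have neg: "(- Q) *v e = - (Q *v e)"
    by (simp add: vec_eq_iff matrix_vector_mult_def sum_negf)
  have "e \<bullet> (P *v (M *v e)) + e \<bullet> (transpose M *v (P *v e)) = - (e \<bullet> (Q *v e))"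
    using arg_cong[OF eq, of "\<lambda>A. e \<bullet> (A *v e)"]
    by (simp add: matrix_vector_mult_add_rdistrib matrix_vector_mul_assoc inner_add_right neg)
  moreover have "e \<bullet> (P *v (M *v e)) = (M *v e) \<bullet> (P *v e)"
    using inner_matrix_symmetric[OF P, of e "M *v e"] by (simp add: inner_commute)
  moreover have "e \<bullet> (transpose M *v (P *v e)) = (M *v e) \<bullet> (P *v e)"
    using dot_lmul_matrix[of "P *v e" M e] by (simp add: inner_commute)
  ultimately show ?thesis by simp
qed

text \<open>The estimator makes \<open>V\<close> nonincreasing but gives no decay of the parameter error \<open>\<eta>\<close>
  itself. Its product with \<open>x\<close> is recovered from the error dynamics: it is what drives the last
  component of \<open>e\<close>, so it must vanish once \<open>e\<close> and \<open>e'\<close> do.\<close>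

lemma estimation_perturbation_tendsto_zero:
  fixes a am :: "'n::{finite,linorder} rvec"
  assumes \<gamma>: "\<gamma> > 0" and P: "sym_pos_def P" and Q: "sym_pos_def Q"
    and lyap: "P ** companion am + transpose (companion am) ** P = - Q"
    and sol: "solution (\<lambda>_. L1_loop a am k \<gamma> P) \<infinity> (\<lambda>t. (x t, u t, xh t, th t))"
    and bdd: "bounded ((\<lambda>t. (x t, u t, xh t, th t)) ` {0..})"
  shows "((\<lambda>t. (th t - theta a am) \<bullet> x t) \<longlongrightarrow> 0) at_top"
proof -
  define e where "e t = xh t - x t" for t
  define \<eta> where "\<eta> t = th t - theta a am" for t
  define y where "y t = \<eta> t \<bullet> x t" for t
  let ?A = "companion am"
  let ?b = "e_last :: 'n rvec"
  have symP: "transpose P = P" using P by (simp add: sym_pos_def_def)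
  have dz: "((\<lambda>t. (x t, u t, xh t, th t)) has_vector_derivative
      L1_loop a am k \<gamma> P (x t, u t, xh t, th t)) (at t within {0..})" if "t \<ge> 0" for t
    using sol that by (simp add: solution_def time_dom_infinity)
  have de: "(e has_vector_derivative ?A *v e t - y t *\<^sub>R ?b) (at t within {0..})"
    if "t \<ge> 0" for t
  proof -
    have "bounded_linear (\<lambda>z :: 'n rvec \<times> real \<times> 'n rvec \<times> 'n rvec. fst (snd (snd z)) - fst z)"
      by (intro bounded_linear_sub bounded_linear_fst_comp bounded_linear_snd_comp
          bounded_linear_ident)
    from bounded_linear.has_vector_derivative[OF this dz[OF that]] show ?thesis
      by (simp add: L1_loop_def e_def[abs_def] y_def \<eta>_def prediction_error_field)
  qed
  have d\<eta>: "(\<eta> has_vector_derivative (\<gamma> * (e t \<bullet> (P *v ?b))) *\<^sub>R x t) (at t within {0..})"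
    if "t \<ge> 0" for t
  proof -
    have "bounded_linear (\<lambda>z :: 'n rvec \<times> real \<times> 'n rvec \<times> 'n rvec. snd (snd (snd z)))"
      by (intro bounded_linear_snd_comp bounded_linear_ident)
    from has_vector_derivative_diff[OF bounded_linear.has_vector_derivative[OF this dz[OF that]]
        has_vector_derivative_const[of "theta a am"]] show ?thesis
      by (simp add: L1_loop_def e_def \<eta>_def[abs_def])
  qed
  have uc: "uniformly_continuous_on {0..} (\<lambda>t. F (x t, u t, xh t, th t))"
    if "continuous_on UNIV F"
    for F :: "'n rvec \<times> real \<times> 'n rvec \<times> 'n rvec \<Rightarrow> real"
    by (rule bounded_solution_uniformly_continuous[OF sol bdd continuous_L1_loop that])

  define V where "V t = e t \<bullet> (P *v e t) + (\<eta> t \<bullet> \<eta> t) / \<gamma>" for t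
  have dV: "(V has_vector_derivative - (e t \<bullet> (Q *v e t))) (at t within {0..})"
    if t: "t \<ge> 0" for t
  proof -
    note dPe = bounded_linear.has_vector_derivative[OF matrix_vector_mul_bounded_linear[of P] de[OF t]]
    note d = has_vector_derivative_add[OF
        bounded_bilinear.has_vector_derivative[OF bounded_bilinear_inner de[OF t] dPe]
        bounded_linear.has_vector_derivative[OF bounded_linear_divide[of \<gamma>]
          bounded_bilinear.has_vector_derivative[OF bounded_bilinear_inner d\<eta>[OF t] d\<eta>[OF t]]]]
    \<comment> \<open>The cross terms \<open>- 2 y e\<^sup>T P b\<close> from the error dynamics and \<open>2 \<eta>\<^sup>T \<eta>' / \<gamma>\<close> from the
      estimator cancel.\<close>
    have "e t \<bullet> (P *v (?A *v e t - y t *\<^sub>R ?b)) + (?A *v e t - y t *\<^sub>R ?b) \<bullet> (P *v e t) +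
        (\<eta> t \<bullet> ((\<gamma> * (e t \<bullet> (P *v ?b))) *\<^sub>R x t) + ((\<gamma> * (e t \<bullet> (P *v ?b))) *\<^sub>R x t) \<bullet> \<eta> t) / \<gamma>
      = 2 * ((?A *v e t) \<bullet> (P *v e t))"
    proof -
      have "e t \<bullet> (P *v (?A *v e t - y t *\<^sub>R ?b)) = (?A *v e t - y t *\<^sub>R ?b) \<bullet> (P *v e t)"
        by (metis inner_commute inner_matrix_symmetric[OF symP])
      moreover have "?b \<bullet> (P *v e t) = e t \<bullet> (P *v ?b)"
        by (metis inner_commute inner_matrix_symmetric[OF symP])
      ultimately show ?thesis
        using \<gamma> by (simp add: inner_diff_left y_def inner_commute[of "x t"] field_simps)
    qed
    with d show ?thesis
      unfolding V_def using lyapunov_equation_form[OF symP lyap, of "e t"] by simp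
  qed
  have Q_nonneg: "v \<bullet> (Q *v v) \<ge> 0" and P_nonneg: "v \<bullet> (P *v v) \<ge> 0" for v
    using P Q unfolding sym_pos_def_def by (cases "v = 0"; force intro: less_imp_le)+
  obtain l where "(V \<longlongrightarrow> l) at_top"
  proof (rule nonincreasing_nonneg_convergent_at_top)
    show "V t \<le> V s" if "0 \<le> s" "s \<le> t" for s t
      by (rule nonpos_derivative_imp_nonincreasing_within[where S = "{0..}", OF _ _ dV])
        (use that Q_nonneg in auto)
    show "V t \<ge> 0" for t using P_nonneg \<gamma> by (simp add: V_def)
  qed
  moreover have "uniformly_continuous_on {0..} (\<lambda>t. - (e t \<bullet> (Q *v e t)))"
  proof -
    have "continuous_on UNIV (\<lambda>z :: 'n rvec \<times> real \<times> 'n rvec \<times> 'n rvec.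
        - ((fst (snd (snd z)) - fst z) \<bullet> (Q *v (fst (snd (snd z)) - fst z))))"
      by (intro continuous_intros)
    from uc[OF this] show ?thesis by (simp only: e_def fst_conv snd_conv)
  qed
  ultimately have "((\<lambda>t. - (e t \<bullet> (Q *v e t))) \<longlongrightarrow> 0) at_top"
    using dV by (intro barbalat[where w = V and l = l]) simp_all
  then have e: "(e \<longlongrightarrow> 0) at_top"
    using tendsto_minus by (intro tendsto_zero_of_pos_def_form[OF Q]) force

  define g where "g t = - (am \<bullet> e t) - y t" for t
  have "((\<lambda>t. ?b \<bullet> e t) has_vector_derivative g t) (at t within {0..})" if "t \<ge> 0" for t
    using bounded_linear.has_vector_derivative[OF bounded_linear_inner_right de[OF that], of ?b]
    by (simp add: g_def inner_diff_right e_last_inner_companion)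
  moreover have "((\<lambda>t. ?b \<bullet> e t) \<longlongrightarrow> ?b \<bullet> 0) at_top" by (intro tendsto_intros e)
  moreover have "uniformly_continuous_on {0..} g"
  proof -
    have "continuous_on UNIV (\<lambda>z :: 'n rvec \<times> real \<times> 'n rvec \<times> 'n rvec.
        - (am \<bullet> (fst (snd (snd z)) - fst z)) - (snd (snd (snd z)) - theta a am) \<bullet> fst z)"
      by (intro continuous_intros)
    from uc[OF this] show ?thesis
      by (simp only: g_def[abs_def] e_def y_def \<eta>_def fst_conv snd_conv)
  qed
  ultimately have "(g \<longlongrightarrow> 0) at_top" by (rule barbalat)
  then have "((\<lambda>t. - (am \<bullet> e t) - g t) \<longlongrightarrow> - (am \<bullet> 0) - 0) at_top"
    by (intro tendsto_intros e)
  then show ?thesis by (simp add: g_def y_def \<eta>_def)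
qed

section \<open>Boundedness of the adaptive loop forces stability of the PI loop\<close>

text \<open>With a perfect prediction and the true parameter, \<open>th' = 0\<close> since \<open>xh - x = 0\<close>, and
  \<open>xh' = x'\<close> since \<open>th - \<theta> = 0\<close>. The set of such states is thus invariant, and the control law
  on it is the unperturbed PI controller.\<close>

lemma L1_loop_contains_PI_loop:
  assumes "solution (\<lambda>_. PI_loop a am k) T z"
  shows "solution (\<lambda>_. L1_loop a am k \<gamma> P) T
    (\<lambda>t. (fst (z t), snd (z t) - K_P k \<bullet> fst (z t), fst (z t), theta a am))"
proof -
  let ?L = "\<lambda>z :: 'a rvec \<times> real.
    (fst z, snd z - K_P k \<bullet> fst z, fst z, 0 :: 'a rvec)"
  have L: "bounded_linear ?L"
    unfolding linear_conv_bounded_linear[symmetric]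
    by (rule linearI) (auto simp: algebra_simps)
  have "L1_loop a am k \<gamma> P (?L y + (0, 0, 0, theta a am)) = ?L (PI_loop a am k y)" for y
  proof (cases y)
    case (Pair x v)
    define u where "u = v - K_P k \<bullet> x"
    have "companion am *v x - (theta a am \<bullet> x - u) *\<^sub>R e_last = plant a x u"
      using prediction_error_field[of am x "theta a am" x u a] by simp
    then show ?thesis
      unfolding Pair
      by (simp add: L1_loop_def PI_loop_def u_def[symmetric])
        (simp add: control_law_def K_P_def K_I_def theta_def e_last_inner_plant algebra_simps)
  qed
  then show ?thesis
    using solution_affine_image[OF assms L, where c = "(0, 0, 0, theta a am)"
        and f' = "\<lambda>_. L1_loop a am k \<gamma> P"] by simp
qed

lemma bounded_L1_imp_bounded_PI:
  assumes "bounded_trajectories (L1_loop a am k \<gamma> P)"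
  shows "bounded_trajectories (PI_loop a am k)"
  unfolding bounded_trajectories_def
proof (intro allI impI)
  fix T and z :: "real \<Rightarrow> 'a rvec \<times> real"
  assume "solution (\<lambda>_. PI_loop a am k) T z"
  then have bdd: "bounded ((\<lambda>t. (fst (z t), snd (z t) - K_P k \<bullet> fst (z t), fst (z t), theta a am))
      ` time_dom T)" (is "bounded (?E ` _)")
    using assms L1_loop_contains_PI_loop unfolding bounded_trajectories_def by blast
  let ?R = "\<lambda>w :: 'a rvec \<times> real \<times> 'a rvec \<times> 'a rvec. (fst w, fst (snd w) + K_P k \<bullet> fst w)"
  have "bounded_linear ?R"
    unfolding linear_conv_bounded_linear[symmetric]
    by (rule linearI) (auto simp: algebra_simps)
  from bounded_linear_image[OF bdd this] show "bounded (z ` time_dom T)"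
    by (simp add: image_image)
qed

lemma linear_PI_loop: "linear (PI_loop a am k)"
proof (rule linearI)
  have plant_add: "plant a (x + y) (u + w) = plant a x u + plant a y w" for x y u w
    by (simp add: plant_def matrix_vector_right_distrib scaleR_add_left)
  show "PI_loop a am k (y + z) = PI_loop a am k y + PI_loop a am k z" for y z
    by (cases y; cases z)
      (simp add: PI_loop_def inner_add_right add_diff_add plant_add)
  have plant_scale: "plant a (r *\<^sub>R x) (r * u) = r *\<^sub>R plant a x u" for r x u
    by (simp add: plant_def matrix_vector_mult_scaleR scaleR_add_right)
  show "PI_loop a am k (r *\<^sub>R y) = r *\<^sub>R PI_loop a am k y" for r y
    by (cases y) (simp add: PI_loop_def plant_scale flip: right_diff_distrib)
qed

theorem proposition1:
  fixes a am :: "real ^ 'n::{finite,linorder}"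
    and k \<gamma> :: real
    and P Q :: "real ^ 'n::{finite,linorder} ^ 'n::{finite,linorder}"
  assumes "\<forall>i. am $ i > 0"
    and "hurwitz (companion am)"
    and "k > 0" and "\<gamma> > 0"
    and "sym_pos_def P" and "sym_pos_def Q"
    and "P ** companion am + transpose (companion am) ** P = - Q"
  shows "(\<forall>T x u th.
      (solution (filtered_loop a k th) T (\<lambda>t. (x t, u t)) \<longrightarrow>
        (\<exists>v. solution (perturbed_PI_loop a am k (\<lambda>t. th t - theta a am)) T (\<lambda>t. (x t, v t)) \<and>
             (\<forall>t\<in>time_dom T. u t = v t - K_P k \<bullet> x t))) \<and>
      (caratheodory_solution (filtered_loop a k th) T (\<lambda>t. (x t, u t)) \<longrightarrow>
        (\<exists>v. caratheodory_solution (perturbed_PI_loop a am k (\<lambda>t. th t - theta a am)) T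
               (\<lambda>t. (x t, v t)) \<and>
             (\<forall>t\<in>time_dom T. u t = v t - K_P k \<bullet> x t)))) \<and>
    (bounded_trajectories (L1_loop a am k \<gamma> P) \<longrightarrow>
      (\<forall>x u xh th.
        solution (\<lambda>_. L1_loop a am k \<gamma> P) \<infinity> (\<lambda>t. (x t, u t, xh t, th t)) \<longrightarrow>
          ((\<lambda>t. \<bar>(th t - theta a am) \<bullet> x t\<bar>) \<longlongrightarrow> 0) at_top \<and>
          (\<exists>v. solution (perturbed_PI_loop a am k (\<lambda>t. th t - theta a am)) \<infinity> (\<lambda>t. (x t, v t)) \<and>
               (\<forall>t\<ge>0. u t = v t - K_P k \<bullet> x t) \<and>
               ((\<lambda>t. k * ((th t - theta a am) \<bullet> x t)) \<longlongrightarrow> 0) at_top))) \<and>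
    (\<not> lyapunov_stable (PI_loop a am k) \<longrightarrow>
      \<not> bounded_trajectories (L1_loop a am k \<gamma> P))"
proof (intro conjI allI impI)
  fix T x u th
  show "\<exists>v. solution (perturbed_PI_loop a am k (\<lambda>t. th t - theta a am)) T (\<lambda>t. (x t, v t)) \<and>
      (\<forall>t\<in>time_dom T. u t = v t - K_P k \<bullet> x t)"
    if "solution (filtered_loop a k th) T (\<lambda>t. (x t, u t))"
    using perturbed_PI_of_filtered[OF that]
    by (intro exI[of _ "\<lambda>t. u t + K_P k \<bullet> x t"]) simp
  show "\<exists>v. caratheodory_solution (perturbed_PI_loop a am k (\<lambda>t. th t - theta a am)) T
        (\<lambda>t. (x t, v t)) \<and> (\<forall>t\<in>time_dom T. u t = v t - K_P k \<bullet> x t)"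
    if "caratheodory_solution (filtered_loop a k th) T (\<lambda>t. (x t, u t))"
    using caratheodory_perturbed_PI_of_filtered[OF that]
    by (intro exI[of _ "\<lambda>t. u t + K_P k \<bullet> x t"]) simp
next
  fix x u xh th
  assume "bounded_trajectories (L1_loop a am k \<gamma> P)"
    and sol: "solution (\<lambda>_. L1_loop a am k \<gamma> P) \<infinity> (\<lambda>t. (x t, u t, xh t, th t))"
  then have "bounded ((\<lambda>t. (x t, u t, xh t, th t)) ` {0..})"
    unfolding bounded_trajectories_def time_dom_infinity[symmetric] by blast
  then have lim: "((\<lambda>t. (th t - theta a am) \<bullet> x t) \<longlongrightarrow> 0) at_top"
    by (rule estimation_perturbation_tendsto_zero[OF assms(4-7) sol])
  then show "((\<lambda>t. \<bar>(th t - theta a am) \<bullet> x t\<bar>) \<longlongrightarrow> 0) at_top"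
    by (rule tendsto_rabs_zero)
  have "((\<lambda>t. k * ((th t - theta a am) \<bullet> x t)) \<longlongrightarrow> 0) at_top"
    using lim by (rule tendsto_mult_right_zero)
  then show "\<exists>v. solution (perturbed_PI_loop a am k (\<lambda>t. th t - theta a am)) \<infinity> (\<lambda>t. (x t, v t)) \<and>
      (\<forall>t\<ge>0. u t = v t - K_P k \<bullet> x t) \<and>
      ((\<lambda>t. k * ((th t - theta a am) \<bullet> x t)) \<longlongrightarrow> 0) at_top"
    using perturbed_PI_of_filtered[OF L1_loop_imp_filtered_loop[OF sol]]
    by (intro exI[of _ "\<lambda>t. u t + K_P k \<bullet> x t"]) simp
next
  assume "\<not> lyapunov_stable (PI_loop a am k)"
  then show "\<not> bounded_trajectories (L1_loop a am k \<gamma> P)"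
    using linear_bounded_imp_lyapunov_stable[OF linear_PI_loop] bounded_L1_imp_bounded_PI by blast
qed

end
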